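(* Let $G$ be a finite simple graph (with nonempty vertex set) without isolated vertices that satisfies at least one of the following properties: (1) $G$ is bipartite; (2) $G$ is unmixed; (3) $G$ is claw-free. Then $\delta(J(G))=\omega(J(G))=\tau_{\max}(G)$.
   Context: Let $V(G)=\{1,\ldots,r\}$, $k$ a field, $R=k[x_1,\ldots,x_r]$ with the standard grading. The cover ideal of $G$ is $J(G)=\bigcap_{\{i,j\}\in E(G)}(x_i,x_j)\subseteq R$. $\omega(J(G))$ is the maximal degree of a minimal generator of $J(G)$. $\tau_{\max}(G)$ is the maximal cardinality of a minimal (with respect to inclusion) vertex cover of $G$. Let $\mathcal{SP}(J(G))=\{\mathbf x\in\mathbb R^r : x_i\ge0 \text{ for all } i,\ x_i+x_j\ge1 \text{ for all } \{i,j\}\in E(G)\}$. With $|\mathbf v|=v_1+\cdots+v_r$, define $\delta(J(G))=\max\{|\mathbf v| : \mathbf v\text{ is a vertex of }\mathcal{SP}(J(G))\}$. $G$ is unmixed if all minimal vertex covers of $G$ have the same size. $G$ is claw-free if it does not contain the complete bipartite graph $K_{1,3}$ as an induced subgraph. *)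

theory Defs
  imports "HOL-Analysis.Analysis" "HOL-Library.Poly_Mapping"
begin

text \<open>
  The vertex set of a graph is a finite type \<open>'v\<close> (automatically nonempty), so that
  \<open>r = CARD('v)\<close>, the space of real vectors indexed by the vertices is \<open>real ^ 'v\<close>, and the
  polynomial ring with one variable per vertex is \<open>('v, 'k) mpoly\<close>. A graph is given by its
  set of edges.
\<close>

section \<open>Graphs\<close>

definition simple_graph :: "'v set set \<Rightarrow> bool" where
  "simple_graph E \<longleftrightarrow> (\<forall>e\<in>E. card e = 2)"

definition no_isolated_vertices :: "'v set set \<Rightarrow> bool" where
  "no_isolated_vertices E \<longleftrightarrow> (\<forall>v. \<exists>e\<in>E. v \<in> e)"

definition vertex_cover :: "'v set set \<Rightarrow> 'v set \<Rightarrow> bool" where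
  "vertex_cover E C \<longleftrightarrow> (\<forall>e\<in>E. C \<inter> e \<noteq> {})"

definition minimal_vertex_cover :: "'v set set \<Rightarrow> 'v set \<Rightarrow> bool" where
  "minimal_vertex_cover E C \<longleftrightarrow> vertex_cover E C \<and> (\<forall>D. D \<subset> C \<longrightarrow> \<not> vertex_cover E D)"

definition tau_max :: "'v::finite set set \<Rightarrow> nat" where
  "tau_max E = Max (card ` {C. minimal_vertex_cover E C})"

definition bipartite :: "'v set set \<Rightarrow> bool" where
  "bipartite E \<longleftrightarrow>
    (\<exists>A B. A \<union> B = UNIV \<and> A \<inter> B = {} \<and> (\<forall>e\<in>E. \<exists>a\<in>A. \<exists>b\<in>B. e = {a, b}))"

definition unmixed :: "'v set set \<Rightarrow> bool" where
  "unmixed E \<longleftrightarrow>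
    (\<forall>C D. minimal_vertex_cover E C \<longrightarrow> minimal_vertex_cover E D \<longrightarrow> card C = card D)"

definition induced_edges :: "'v set set \<Rightarrow> 'v set \<Rightarrow> 'v set set" where
  "induced_edges E W = {e \<in> E. e \<subseteq> W}"

definition complete_bipartite :: "'v set \<Rightarrow> 'v set \<Rightarrow> 'v set set" where
  "complete_bipartite A B = {{a, b} | a b. a \<in> A \<and> b \<in> B}"

definition claw_free :: "'v set set \<Rightarrow> bool" where
  "claw_free E \<longleftrightarrow>
    \<not> (\<exists>c L. c \<notin> L \<and> card L = 3 \<and> induced_edges E (insert c L) = complete_bipartite {c} L)"

section \<open>Polynomials and ideals\<close>

type_synonym ('v, 'k) mpoly = "('v \<Rightarrow>\<^sub>0 nat) \<Rightarrow>\<^sub>0 'k"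

definition var :: "'v \<Rightarrow> ('v, 'k::comm_ring_1) mpoly" where
  "var v = Poly_Mapping.single (Poly_Mapping.single v 1) 1"

definition mon_degree :: "('v::finite \<Rightarrow>\<^sub>0 nat) \<Rightarrow> nat" where
  "mon_degree m = (\<Sum>v\<in>UNIV. Poly_Mapping.lookup m v)"

definition homogeneous :: "('v::finite, 'k::comm_ring_1) mpoly \<Rightarrow> bool" where
  "homogeneous f \<longleftrightarrow> (\<exists>d. \<forall>m\<in>Poly_Mapping.keys f. mon_degree m = d)"

definition total_degree :: "('v::finite, 'k::comm_ring_1) mpoly \<Rightarrow> nat" where
  "total_degree f = Max (insert 0 (mon_degree ` Poly_Mapping.keys f))"

text \<open>Ideals are the submodules of a commutative ring regarded as a module over itself.\<close>

lemma module_times: "module ((*) :: 'a::comm_ring_1 \<Rightarrow> 'a \<Rightarrow> 'a)"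
  by unfold_locales (simp_all add: algebra_simps)

definition ideal_gen :: "'a::comm_ring_1 set \<Rightarrow> 'a set" where
  "ideal_gen S = module.span (*) S"

definition minimal_homogeneous_generators ::
    "('v::finite, 'k::comm_ring_1) mpoly set \<Rightarrow> ('v, 'k) mpoly set \<Rightarrow> bool" where
  "minimal_homogeneous_generators I B \<longleftrightarrow>
    (\<forall>f\<in>B. homogeneous f) \<and> ideal_gen B = I \<and> (\<forall>B'. B' \<subset> B \<longrightarrow> ideal_gen B' \<noteq> I)"

text \<open>
  For a homogeneous ideal \<open>I\<close> over a field, the degrees occurring in a minimal homogeneous
  generating set do not depend on the choice of that set; all choices are taken together here,
  so that no particular one has to be fixed.
\<close>

definition omega :: "('v::finite, 'k::comm_ring_1) mpoly set \<Rightarrow> nat" where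
  "omega I = Max {total_degree f | f B. minimal_homogeneous_generators I B \<and> f \<in> B}"

definition cover_ideal :: "'v set set \<Rightarrow> ('v, 'k::comm_ring_1) mpoly set" where
  "cover_ideal E = (\<Inter>e\<in>E. ideal_gen (var ` e))"

section \<open>The symbolic polyhedron of the cover ideal\<close>

definition symbolic_polyhedron :: "'v::finite set set \<Rightarrow> (real ^ 'v) set" where
  "symbolic_polyhedron E =
    {x. (\<forall>i. 0 \<le> x $ i) \<and> (\<forall>i j. {i, j} \<in> E \<longrightarrow> 1 \<le> x $ i + x $ j)}"

definition delta :: "'v::finite set set \<Rightarrow> real" where
  "delta E = Max {(\<Sum>i\<in>UNIV. v $ i) | v. v extreme_point_of symbolic_polyhedron E}"

end

theory Submission
  imports Defs
begin

text \<open>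
  Both invariants are compared with \<open>\<tau>\<^sub>m\<^sub>a\<^sub>x\<close>.

  For the algebraic half (\<open>omega_cover_ideal\<close>), note that a polynomial lies in the cover
  ideal when the support of each of its monomials is a vertex cover, so the squarefree monomials of
  the minimal vertex covers generate it, and none of them can be omitted. Any other
  minimal homogeneous generating set has no element of degree above \<open>\<tau>\<^sub>m\<^sub>a\<^sub>x\<close>: such an element
  does not contribute to the components of degree at most \<open>\<tau>\<^sub>m\<^sub>a\<^sub>x\<close>, which already produce these
  monomials.

  For the polyhedral half (\<open>delta_eq_tau_max\<close>), the indicator vector of a minimal vertex cover is a
  vertex of the symbolic polyhedron, which gives one inequality. Conversely, let \<open>x\<close> be a vertex.
  It cannot be moved along a direction that preserves the tight constraints
  (\<open>extreme_point_rigid\<close>), which forces its coordinates into \<open>{0, 1/2, 1}\<close> and gives every positive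
  coordinate a tight edge. Let \<open>V\<^sub>1\<close> and \<open>H\<close> be the sets of vertices with value \<open>1\<close> and \<open>1/2\<close>; then
  \<open>|x| = |V\<^sub>1| + |H|/2\<close>. For every maximal independent set \<open>S\<close> of the subgraph induced by \<open>H\<close> the
  set \<open>V\<^sub>1 \<union> (H - S)\<close> is a minimal vertex cover (\<open>minimal_vertex_cover_of_extreme_point\<close>). It is at
  least as large as \<open>|x|\<close> as soon as \<open>2 |S| \<le> |H|\<close>, so it remains to find such an \<open>S\<close>.

  If the graph is bipartite, \<open>H\<close> is empty. If it is unmixed, the maximal independent sets of \<open>H\<close>
  all have the same size, and in such a graph without isolated vertices an independent set has at
  least as many neighbours as elements (\<open>card_independent_le_card_neighbours\<close>). If it is
  claw-free, a dominating set with at most half of the vertices, which exists by Ore's theorem, can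
  be made independent by exchanging vertices (\<open>claw_free_maximal_independent_half\<close>).
\<close>

section \<open>Vertex covers\<close>

lemma vertex_cover_mono: "vertex_cover E C \<Longrightarrow> C \<subseteq> D \<Longrightarrow> vertex_cover E D"
  by (fastforce simp: vertex_cover_def)

lemma vertex_cover_contains_minimal:
  fixes E :: "'v::finite set set"
  assumes "vertex_cover E C"
  obtains D where "D \<subseteq> C" "minimal_vertex_cover E D"
proof -
  obtain D where "D \<in> {D. vertex_cover E D}" "D \<subseteq> C"
    "\<And>D'. D' \<in> {D. vertex_cover E D} \<Longrightarrow> D' \<subseteq> D \<Longrightarrow> D = D'"
    using finite_has_minimal2[of "{D. vertex_cover E D}" C] assms by auto
  then have "D \<subseteq> C" "minimal_vertex_cover E D"
    unfolding minimal_vertex_cover_def by auto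
  then show thesis by (rule that)
qed

text \<open>
  Supersets of covers are covers, so minimality can be tested by dropping a single vertex \<open>u\<close>. This
  uncovers exactly the edges at \<open>u\<close> whose other end is outside \<open>C\<close>, called private to \<open>u\<close> below.
\<close>

lemma minimal_vertex_cover_iff_private_edges:
  assumes "simple_graph E"
  shows "minimal_vertex_cover E C \<longleftrightarrow>
    (\<forall>u v. {u, v} \<in> E \<longrightarrow> u \<in> C \<or> v \<in> C) \<and> (\<forall>u\<in>C. \<exists>v. v \<notin> C \<and> {u, v} \<in> E)"
    (is "_ \<longleftrightarrow> ?cover \<and> ?private")
proof -
  have cover: "vertex_cover E D \<longleftrightarrow> (\<forall>u v. {u, v} \<in> E \<longrightarrow> u \<in> D \<or> v \<in> D)" for D
    using assms unfolding vertex_cover_def simple_graph_def card_2_iff by fastforce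
  have noloop: "{u, u} \<notin> E" for u
    using assms by (force simp: simple_graph_def)
  show ?thesis
  proof
    assume min: "minimal_vertex_cover E C"
    then have c: ?cover by (simp add: minimal_vertex_cover_def cover)
    have ?private
    proof
      fix u assume "u \<in> C"
      then have "\<not> vertex_cover E (C - {u})"
        using min by (auto simp: minimal_vertex_cover_def)
      then obtain a b where "{a, b} \<in> E" "a \<notin> C - {u}" "b \<notin> C - {u}"
        by (auto simp: cover)
      with c noloop show "\<exists>v. v \<notin> C \<and> {u, v} \<in> E"
        by (metis Diff_iff insert_commute singletonD)
    qed
    with c show "?cover \<and> ?private" ..
  next
    assume a: "?cover \<and> ?private"
    show "minimal_vertex_cover E C"
      unfolding minimal_vertex_cover_def
    proof (intro conjI allI impI)
      show "vertex_cover E C" using a by (simp add: cover)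
      fix D assume "D \<subset> C"
      then obtain u where "u \<in> C" "u \<notin> D" by auto
      with a \<open>D \<subset> C\<close> show "\<not> vertex_cover E D"
        unfolding cover by blast
    qed
  qed
qed

lemma card_minimal_vertex_cover_le_tau_max:
  "minimal_vertex_cover E C \<Longrightarrow> card C \<le> tau_max E"
  unfolding tau_max_def by (rule Max_ge) auto

lemma tau_max_attained:
  fixes E :: "'v::finite set set"
  assumes "simple_graph E"
  obtains C where "minimal_vertex_cover E C" "card C = tau_max E"
proof -
  have "vertex_cover E UNIV"
    using assms by (auto simp: vertex_cover_def simple_graph_def)
  then have "{C. minimal_vertex_cover E C} \<noteq> {}"
    using vertex_cover_contains_minimal by blast
  then have "tau_max E \<in> card ` {C. minimal_vertex_cover E C}"
    unfolding tau_max_def by (intro Max_in) auto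
  then show thesis using that by auto
qed

section \<open>Small maximal independent sets\<close>

text \<open>
  Adjacency is given on a finite part \<open>W\<close> of the type, because the results are needed for
  induced subgraphs. A maximal independent set is the same as one that is both independent and
  dominating. The aim is to find one that contains at most half of the vertices.
\<close>

locale finite_adjacency =
  fixes W :: "'a set" and R :: "'a \<Rightarrow> 'a \<Rightarrow> bool"
  assumes finite_vertices: "finite W"
    and adj_sym: "R u v \<Longrightarrow> R v u"
    and adj_irrefl: "\<not> R u u"
begin

definition independent :: "'a set \<Rightarrow> bool" where
  "independent S \<longleftrightarrow> S \<subseteq> W \<and> (\<forall>u\<in>S. \<forall>v\<in>S. \<not> R u v)"

definition dominating :: "'a set \<Rightarrow> bool" where
  "dominating D \<longleftrightarrow> D \<subseteq> W \<and> (\<forall>w\<in>W - D. \<exists>d\<in>D. R w d)"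

definition neighbours :: "'a set \<Rightarrow> 'a set" where
  "neighbours A = {w \<in> W. \<exists>a\<in>A. R a w}"

lemma extend_independent_within:
  assumes "independent A" "A \<subseteq> U" "U \<subseteq> W"
  obtains B where "A \<subseteq> B" "B \<subseteq> U" "independent B" "\<And>w. w \<in> U - B \<Longrightarrow> \<exists>b\<in>B. R w b"
proof -
  let ?F = "{B. B \<subseteq> U \<and> independent B}"
  have "finite ?F"
    using finite_vertices by (intro finite_subset[of ?F "Pow W"]) (auto simp: independent_def)
  then obtain B where B: "B \<in> ?F" "A \<subseteq> B" "\<And>B'. B' \<in> ?F \<Longrightarrow> B \<subseteq> B' \<Longrightarrow> B = B'"
    using finite_has_maximal2[of ?F A] assms by auto
  show thesis
  proof (rule that[of B])
    fix w assume w: "w \<in> U - B"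
    then have "insert w B \<notin> ?F" using B(3)[of "insert w B"] by auto
    then obtain u v where "u \<in> insert w B" "v \<in> insert w B" "R u v"
      using w B(1) assms(3) by (auto simp: independent_def)
    then show "\<exists>b\<in>B. R w b"
      using B(1) adj_sym adj_irrefl by (auto simp: independent_def)
  qed (use B in auto)
qed

lemma extend_independent:
  assumes "independent A"
  obtains B where "A \<subseteq> B" "independent B" "dominating B"
proof -
  have "A \<subseteq> W" using assms by (simp add: independent_def)
  with assms obtain B where "A \<subseteq> B" "B \<subseteq> W" "independent B"
    "\<And>w. w \<in> W - B \<Longrightarrow> \<exists>b\<in>B. R w b"
    using extend_independent_within[OF assms _ order_refl] by blast
  then show thesis by (intro that) (auto simp: dominating_def)
qed

text \<open>
  An exchange argument. Choose \<open>B\<close> maximal independent among the neighbours of \<open>A\<close> and extend it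
  to a maximal independent set \<open>B \<union> Z\<close>. By the choice of \<open>B\<close>, the set \<open>Z\<close> avoids the neighbours of
  \<open>A\<close>, so \<open>A \<union> Z\<close> is independent as well and equicardinality gives \<open>|A - Z| \<le> |B|\<close>. The part
  \<open>A \<inter> Z\<close> has no neighbour in \<open>B\<close>, and it is a proper part of \<open>A\<close> because \<open>B\<close> is nonempty; so
  induction bounds it by the number of the remaining neighbours of \<open>A\<close>.
\<close>

lemma card_independent_le_card_neighbours:
  assumes no_isolated: "\<And>w. w \<in> W \<Longrightarrow> \<exists>u\<in>W. R w u"
    and same_card: "\<And>S T. independent S \<Longrightarrow> dominating S \<Longrightarrow> independent T \<Longrightarrow> dominating T \<Longrightarrow>
      card S = card T"
    and "independent A"
  shows "card A \<le> card (neighbours A)"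
proof -
  have fin: "finite X" if "X \<subseteq> W" for X
    using that finite_vertices by (rule finite_subset)
  have "finite A" using assms(3) fin by (simp add: independent_def)
  then show ?thesis using \<open>independent A\<close>
  proof (induction A rule: finite_psubset_induct)
    case (psubset A)
    have A: "A \<subseteq> W" using psubset.prems by (simp add: independent_def)
    show ?case
    proof (cases "A = {}")
      case False
      have N: "neighbours A \<subseteq> W" by (auto simp: neighbours_def)
      have "independent {}" by (simp add: independent_def)
      then obtain B where "{} \<subseteq> B" and B: "B \<subseteq> neighbours A" "independent B"
        "\<And>w. w \<in> neighbours A - B \<Longrightarrow> \<exists>b\<in>B. R w b"
        using extend_independent_within[OF \<open>independent {}\<close> empty_subsetI N] by blast
      obtain M where M: "B \<subseteq> M" "independent M" "dominating M"
        using extend_independent[OF B(2)] .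
      have MW: "M \<subseteq> W" using M(2) by (simp add: independent_def)
      define Z where "Z = M - B"
      have Z: "z \<notin> neighbours A" if "z \<in> Z" for z
        using that B(3)[of z] M(1,2) by (auto simp: Z_def independent_def)
      have "\<not> R a z \<and> \<not> R z a" if "a \<in> A" "z \<in> Z" for a z
        using that Z[of z] MW adj_sym[of z a] by (auto simp: Z_def neighbours_def)
      then have "independent (A \<union> Z)"
        using psubset.prems M(2) by (auto simp: Z_def independent_def)
      then obtain T where T: "A \<union> Z \<subseteq> T" "independent T" "dominating T"
        by (rule extend_independent)
      have "card (A \<union> Z) \<le> card T"
        using T fin by (intro card_mono) (auto simp: independent_def)
      also have "card T = card M" using same_card T M by blast
      also have "card M = card B + card Z"
        using M(1) fin[OF MW] by (simp add: Z_def card_Diff_subset card_mono finite_subset)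
      also have "card (A \<union> Z) = card (A - Z) + card Z"
        using fin[OF A] fin[OF MW]
        by (subst Un_Diff_cancel2[symmetric], intro card_Un_disjoint) (auto simp: Z_def)
      finally have exchange: "card (A - Z) \<le> card B" by simp
      have "neighbours A \<noteq> {}"
        using False A no_isolated by (fastforce simp: neighbours_def)
      then have "B \<noteq> {}" using B(3) by auto
      then obtain a b where "a \<in> A" "b \<in> B" "R a b"
        using B(1) unfolding neighbours_def by blast
      then have "A \<inter> Z \<subset> A"
        using M(1,2) by (auto simp: Z_def independent_def)
      moreover have "independent (A \<inter> Z)"
        using psubset.prems by (auto simp: independent_def)
      ultimately have "card (A \<inter> Z) \<le> card (neighbours (A \<inter> Z))"
        by (rule psubset.IH)
      also have "\<dots> \<le> card (neighbours A - B)"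
      proof (rule card_mono)
        show "finite (neighbours A - B)" using fin[OF N] by simp
        show "neighbours (A \<inter> Z) \<subseteq> neighbours A - B"
          using M(1,2) by (auto simp: Z_def neighbours_def independent_def)
      qed
      also have "\<dots> = card (neighbours A) - card B"
        using B(1) fin[OF N] by (simp add: card_Diff_subset finite_subset)
      finally have "card (A - Z) + card (A \<inter> Z) \<le> card (neighbours A)"
        using exchange card_mono[OF fin[OF N] B(1)] by linarith
      moreover have "card (A - Z) + card (A \<inter> Z) = card A"
        using fin[OF A]
        by (subst card_Un_disjoint[symmetric]) (auto intro: arg_cong[where f = card])
      ultimately show ?thesis by simp
    qed simp
  qed
qed

text \<open>
  The neighbours of an independent set lie in its complement, so the complement is at least as
  large as the set.
\<close>

lemma equicardinal_maximal_independent_half: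
  assumes "\<And>w. w \<in> W \<Longrightarrow> \<exists>u\<in>W. R w u"
    and "\<And>S T. independent S \<Longrightarrow> dominating S \<Longrightarrow> independent T \<Longrightarrow> dominating T \<Longrightarrow>
      card S = card T"
  obtains S where "independent S" "dominating S" "2 * card S \<le> card W"
proof -
  have "independent {}" by (simp add: independent_def)
  then obtain S where S: "independent S" "dominating S" by (rule extend_independent)
  then have SW: "S \<subseteq> W" by (simp add: independent_def)
  have "card S \<le> card (neighbours S)"
    using assms S(1) by (rule card_independent_le_card_neighbours)
  also have "\<dots> \<le> card (W - S)"
    using S(1) finite_vertices by (intro card_mono) (auto simp: neighbours_def independent_def)
  also have "\<dots> = card W - card S"
    using SW finite_vertices by (simp add: card_Diff_subset finite_subset)
  finally have "2 * card S \<le> card W"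
    using card_mono[OF finite_vertices SW] by linarith
  with S show thesis by (rule that)
qed

text \<open>
  Ore's theorem: the complement of a minimal dominating set \<open>D\<close> is again dominating, since a vertex
  of \<open>D\<close> all of whose neighbours lie in \<open>D\<close> could be removed from \<open>D\<close>. One of the two sets has at
  most half of the vertices.
\<close>

lemma dominating_half:
  assumes no_isolated: "\<And>w. w \<in> W \<Longrightarrow> \<exists>u\<in>W. R w u"
  obtains D where "dominating D" "2 * card D \<le> card W"
proof -
  have "finite {D. dominating D}"
    using finite_vertices by (intro finite_subset[of "{D. dominating D}" "Pow W"]) (auto simp: dominating_def)
  moreover have "dominating W" by (simp add: dominating_def)
  ultimately obtain D where D: "dominating D" "\<And>D'. dominating D' \<Longrightarrow> D' \<subseteq> D \<Longrightarrow> D = D'"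
    using finite_has_minimal2[of "{D. dominating D}" W] by auto
  have DW: "D \<subseteq> W" using D(1) by (simp add: dominating_def)
  have "dominating (W - D)"
    unfolding dominating_def
  proof (intro conjI ballI)
    fix w assume "w \<in> W - (W - D)"
    then have w: "w \<in> D" by simp
    show "\<exists>d\<in>W - D. R w d"
    proof (rule ccontr)
      assume outside: "\<not> (\<exists>d\<in>W - D. R w d)"
      obtain u where "u \<in> W" "R w u" using no_isolated w DW by blast
      then have u: "u \<in> D - {w}" "R w u" using outside adj_irrefl by auto
      have "dominating (D - {w})"
        unfolding dominating_def
      proof (intro conjI ballI)
        fix x assume x: "x \<in> W - (D - {w})"
        show "\<exists>d\<in>D - {w}. R x d"
        proof (cases "x = w")
          case False
          then obtain d where "d \<in> D" "R x d"
            using x D(1) by (auto simp: dominating_def)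
          then show ?thesis using x False outside adj_sym by blast
        qed (use u in blast)
      qed (use DW in auto)
      then show False using D(2)[of "D - {w}"] w by blast
    qed
  qed simp
  moreover have "card (W - D) = card W - card D"
    using DW finite_vertices by (simp add: card_Diff_subset finite_subset)
  ultimately show thesis
    using that[of D] that[of "W - D"] D(1) by linarith
qed

text \<open>
  The argument of Allan and Laskar that a claw-free graph has an independent set among its
  smallest dominating sets. If two vertices \<open>u\<close> and \<open>v\<close> of a dominating set \<open>D\<close> are adjacent,
  consider the vertices outside \<open>D\<close> that only \<open>v\<close> dominates. If there are none, drop \<open>v\<close>.
  Otherwise any two of them are adjacent, for together with \<open>u\<close> they would form a claw around \<open>v\<close>;
  so \<open>v\<close> can be replaced by any one of them, which keeps the size and removes the edge between
  \<open>u\<close> and \<open>v\<close> without creating a new one. Either way the number of vertices plus the number of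
  inner arcs decreases.
\<close>

lemma claw_free_maximal_independent_half:
  assumes no_isolated: "\<And>w. w \<in> W \<Longrightarrow> \<exists>u\<in>W. R w u"
    and no_claw: "\<And>c p q r. R c p \<Longrightarrow> R c q \<Longrightarrow> R c r \<Longrightarrow> p \<noteq> q \<Longrightarrow> p \<noteq> r \<Longrightarrow> q \<noteq> r \<Longrightarrow>
      R p q \<or> R p r \<or> R q r"
  obtains S where "independent S" "dominating S" "2 * card S \<le> card W"
proof -
  define arcs where "arcs D = {(u, v). u \<in> D \<and> v \<in> D \<and> R u v}" for D
  have fin_arcs: "finite (arcs D)" if "finite D" for D
    using that by (intro finite_subset[of "arcs D" "D \<times> D"]) (auto simp: arcs_def)
  let ?P = "\<lambda>D. dominating D \<and> 2 * card D \<le> card W"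
  let ?weight = "\<lambda>D. card D + card (arcs D)"
  obtain D where D: "dominating D" "2 * card D \<le> card W"
    and least: "\<And>D'. dominating D' \<Longrightarrow> 2 * card D' \<le> card W \<Longrightarrow> ?weight D \<le> ?weight D'"
    using dominating_half[OF no_isolated] ex_has_least_nat[of ?P _ ?weight] by metis
  have DW: "D \<subseteq> W" using D(1) by (simp add: dominating_def)
  then have finD: "finite D" using finite_vertices by (rule finite_subset)
  have "\<not> R u v" if uv: "u \<in> D" "v \<in> D" for u v
  proof
    assume "R u v"
    then have vu: "R v u" "u \<noteq> v" using adj_sym adj_irrefl by blast+
    \<comment> \<open>The private neighbours of \<open>v\<close> outside \<open>D\<close>.\<close>
    define P where "P = {w \<in> W - D. \<forall>d\<in>D - {v}. \<not> R w d}"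
    have P_adj: "R v w" if "w \<in> P" for w
      using that D(1) adj_sym by (fastforce simp: P_def dominating_def)
    show False
    proof (cases "P = {}")
      case True
      have dom: "dominating (D - {v})"
        unfolding dominating_def
      proof (intro conjI ballI)
        fix x assume "x \<in> W - (D - {v})"
        then show "\<exists>d\<in>D - {v}. R x d"
          using True vu uv by (cases "x = v") (auto simp: P_def)
      qed (use DW in auto)
      have "card (D - {v}) < card D" using finD uv(2) by (rule card_Diff1_less)
      moreover have "card (arcs (D - {v})) \<le> card (arcs D)"
        using fin_arcs[OF finD] by (intro card_mono) (auto simp: arcs_def)
      ultimately show False using least[OF dom] D(2) by linarith
    next
      case False
      then obtain w where w: "w \<in> P" by blast
      define D' where "D' = insert w (D - {v})"
      have dom: "dominating D'"
        unfolding dominating_def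
      proof (intro conjI ballI)
        fix x assume x: "x \<in> W - D'"
        consider "x = v" | "x \<in> P" | "x \<in> W - D" "x \<notin> P"
          using x by (auto simp: D'_def)
        then show "\<exists>d\<in>D'. R x d"
        proof cases
          case 1
          then show ?thesis using vu uv by (auto simp: D'_def)
        next
          case 2
          have "x \<noteq> w" using x by (auto simp: D'_def)
          moreover have "u \<noteq> w" "u \<noteq> x" "\<not> R u w" "\<not> R u x"
            using w 2 uv vu(2) adj_sym by (auto simp: P_def)
          ultimately have "R x w"
            using no_claw[of v u w x] vu(1) P_adj[OF w] P_adj[OF 2] adj_sym by blast
          then show ?thesis by (auto simp: D'_def)
        next
          case 3
          then show ?thesis by (auto simp: D'_def P_def)
        qed
      qed (use DW w in \<open>auto simp: D'_def P_def\<close>)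
      have card: "card D' = card D"
        using w uv finD card_Suc_Diff1[of D v] by (auto simp: D'_def P_def)
      have "arcs D' \<subset> arcs D"
      proof (rule psubsetI)
        show "arcs D' \<subseteq> arcs D"
          using w adj_sym adj_irrefl by (auto simp: arcs_def D'_def P_def)
        have "(u, v) \<in> arcs D" using \<open>R u v\<close> uv by (simp add: arcs_def)
        moreover have "(u, v) \<notin> arcs D'"
          using w uv by (auto simp: arcs_def D'_def P_def)
        ultimately show "arcs D' \<noteq> arcs D" by blast
      qed
      then have "card (arcs D') < card (arcs D)"
        using fin_arcs[OF finD] by (simp add: psubset_card_mono)
      then show False using least[OF dom] card D(2) by linarith
    qed
  qed
  then have "independent D" using DW by (simp add: independent_def)
  then show thesis using D by (rule that)
qed

end

section \<open>Vertices of the symbolic polyhedron\<close>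

lemma eventually_nonneg_perturbation:
  fixes a b :: real
  assumes "0 \<le> a" "b \<noteq> 0 \<Longrightarrow> 0 < a"
  shows "\<forall>\<^sub>F t in at_right 0. 0 \<le> a + t * b"
proof (cases "b = 0")
  case False
  have "((\<lambda>t. a + t * b) \<longlongrightarrow> a + 0 * b) (at_right 0)"
    by (intro tendsto_intros)
  then have "\<forall>\<^sub>F t in at_right 0. 0 < a + t * b"
    using assms(2)[OF False] by (intro order_tendstoD(1)) auto
  then show ?thesis by (rule eventually_mono) simp
qed (use assms(1) in simp)

text \<open>
  A small step in direction \<open>d\<close> can only violate a constraint that holds with equality, and the
  assumptions say that \<open>d\<close> leaves the value of each of these unchanged.
\<close>

lemma eventually_in_symbolic_polyhedron:
  fixes x d :: "real ^ 'v::finite"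
  assumes x: "x \<in> symbolic_polyhedron E"
    and pos: "\<And>i. d $ i \<noteq> 0 \<Longrightarrow> 0 < x $ i"
    and tight: "\<And>i j. {i, j} \<in> E \<Longrightarrow> x $ i + x $ j = 1 \<Longrightarrow> d $ i + d $ j = 0"
  shows "\<forall>\<^sub>F t in at_right 0. x + t *\<^sub>R d \<in> symbolic_polyhedron E"
proof -
  have "\<forall>\<^sub>F t in at_right 0. \<forall>i. 0 \<le> x $ i + t * d $ i"
  proof (rule eventually_all_finite, rule eventually_nonneg_perturbation)
    show "0 \<le> x $ i" for i using x by (simp add: symbolic_polyhedron_def)
  qed (rule pos)
  moreover have "\<forall>\<^sub>F t in at_right 0. \<forall>i j. {i, j} \<in> E \<longrightarrow>
      0 \<le> (x $ i + x $ j - 1) + t * (d $ i + d $ j)"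
  proof (intro eventually_all_finite)
    fix i j
    show "\<forall>\<^sub>F t in at_right 0. {i, j} \<in> E \<longrightarrow> 0 \<le> (x $ i + x $ j - 1) + t * (d $ i + d $ j)"
    proof (cases "{i, j} \<in> E")
      case True
      then have "1 \<le> x $ i + x $ j" using x by (simp add: symbolic_polyhedron_def)
      then have "\<forall>\<^sub>F t in at_right 0. 0 \<le> (x $ i + x $ j - 1) + t * (d $ i + d $ j)"
        using tight[OF True] by (intro eventually_nonneg_perturbation) (auto simp: order_less_le)
      then show ?thesis by (rule eventually_mono) simp
    qed simp
  qed
  ultimately show ?thesis
    by eventually_elim (auto simp: symbolic_polyhedron_def algebra_simps)
qed

text \<open>
  The hypotheses hold for \<open>- d\<close> as well, so a nonzero \<open>d\<close> would give a segment around \<open>x\<close>.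
  Everything used about an extreme point comes from this rigidity: each structural property
  below is proved by exhibiting the direction in which the point could move if it failed.
\<close>

lemma extreme_point_rigid:
  fixes x d :: "real ^ 'v::finite"
  assumes x: "x extreme_point_of symbolic_polyhedron E"
    and pos: "\<And>i. d $ i \<noteq> 0 \<Longrightarrow> 0 < x $ i"
    and tight: "\<And>i j. {i, j} \<in> E \<Longrightarrow> x $ i + x $ j = 1 \<Longrightarrow> d $ i + d $ j = 0"
  shows "d = 0"
proof (rule ccontr)
  assume d: "d \<noteq> 0"
  have xP: "x \<in> symbolic_polyhedron E" using x by (simp add: extreme_point_of_def)
  have "\<forall>\<^sub>F t in at_right 0. x + t *\<^sub>R d \<in> symbolic_polyhedron E"
    using xP pos tight by (rule eventually_in_symbolic_polyhedron)
  moreover have "\<forall>\<^sub>F t in at_right 0. x + t *\<^sub>R (- d) \<in> symbolic_polyhedron E"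
    using xP pos tight by (intro eventually_in_symbolic_polyhedron) (auto simp: add_eq_0_iff)
  ultimately have "\<forall>\<^sub>F t in at_right 0. x + t *\<^sub>R d \<in> symbolic_polyhedron E \<and>
      x + t *\<^sub>R (- d) \<in> symbolic_polyhedron E \<and> (0::real) < t"
    by (intro eventually_conj eventually_at_right_less)
  then obtain t :: real where t: "x + t *\<^sub>R d \<in> symbolic_polyhedron E"
    "x + t *\<^sub>R (- d) \<in> symbolic_polyhedron E" "0 < t"
    using eventually_happens trivial_limit_at_right_real by blast
  have "x = midpoint (x + t *\<^sub>R d) (x + t *\<^sub>R (- d))"
    by (simp add: midpoint_def algebra_simps flip: scaleR_2)
  moreover have "x + t *\<^sub>R d \<noteq> x + t *\<^sub>R (- d)"
  proof
    assume eq: "x + t *\<^sub>R d = x + t *\<^sub>R (- d)"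
    have "d $ i = 0" for i
      using arg_cong[OF eq, of "\<lambda>y. y $ i"] t(3) by simp
    then show False using d by (simp add: vec_eq_iff)
  qed
  ultimately have "x \<in> open_segment (x + t *\<^sub>R d) (x + t *\<^sub>R (- d))"
    by (metis midpoint_in_open_segment)
  then show False using x t by (auto simp: extreme_point_of_def)
qed

definition half_vertices :: "real ^ 'v \<Rightarrow> 'v set" where
  "half_vertices x = {i. x $ i = 1/2}"

lemma in_half_vertices_iff: "i \<in> half_vertices x \<longleftrightarrow> x $ i = 1/2"
  by (simp add: half_vertices_def)

context
  fixes E :: "'v::finite set set" and x :: "real ^ 'v"
  assumes ext: "x extreme_point_of symbolic_polyhedron E"
begin

lemma extreme_point_nonneg: "0 \<le> x $ i"
  and extreme_point_edge: "{i, j} \<in> E \<Longrightarrow> 1 \<le> x $ i + x $ j"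
  using ext by (simp_all add: extreme_point_of_def symbolic_polyhedron_def)

text \<open>
  Otherwise the coordinate at \<open>v\<close> could be moved on its own.
\<close>

lemma extreme_point_tight_edge:
  assumes "0 < x $ v"
  obtains u where "{v, u} \<in> E" "x $ u = 1 - x $ v"
proof (rule ccontr)
  assume "\<not> thesis"
  then have no_tight: "x $ v + x $ u \<noteq> 1" if "{v, u} \<in> E" for u
    using that \<open>\<And>u. {v, u} \<in> E \<Longrightarrow> x $ u = 1 - x $ v \<Longrightarrow> thesis\<close>[of u] by auto
  have "axis v (1::real) = 0"
  proof (rule extreme_point_rigid[OF ext])
    show "0 < x $ i" if "axis v (1::real) $ i \<noteq> 0" for i
      using that assms by (auto simp: axis_def split: if_splits)
    show "axis v (1::real) $ i + axis v 1 $ j = 0" if "{i, j} \<in> E" "x $ i + x $ j = 1" for i j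
      using that no_tight[of i] no_tight[of j] by (auto simp: axis_def insert_commute)
  qed
  then show False by (simp add: axis_eq_0_iff)
qed

text \<open>
  Move all coordinates strictly between \<open>0\<close> and \<open>1/2\<close> up and all those above \<open>1/2\<close> other than
  \<open>1\<close> down, at the same speed. An edge whose constraint is tight joins a value \<open>a\<close> to \<open>1 - a\<close>,
  so the two motions cancel.
\<close>

lemma extreme_point_half_integral: "x $ i \<in> {0, 1/2, 1}"
proof -
  define d :: "real ^ 'v" where
    "d = (\<chi> i. if 0 < x $ i \<and> x $ i < 1/2 then 1 else if 1/2 < x $ i \<and> x $ i \<noteq> 1 then -1 else 0)"
  have "d = 0"
  proof (rule extreme_point_rigid[OF ext])
    show "0 < x $ i" if "d $ i \<noteq> 0" for i
      using that by (auto simp: d_def split: if_splits)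
    show "d $ i + d $ j = 0" if "{i, j} \<in> E" "x $ i + x $ j = 1" for i j
      using that(2) extreme_point_nonneg[of i] extreme_point_nonneg[of j] by (auto simp: d_def)
  qed
  then have "d $ i = 0" by simp
  then show ?thesis
    using extreme_point_nonneg[of i] by (auto simp: d_def split: if_splits)
qed

lemma extreme_point_sum:
  "(\<Sum>i\<in>UNIV. x $ i) = real (card {i. x $ i = 1}) + real (card (half_vertices x)) / 2"
proof -
  have count: "(\<Sum>i\<in>UNIV. of_bool (P i)) = real (card {i. P i})" for P :: "'v \<Rightarrow> bool"
    by simp
  have "x $ i = of_bool (x $ i = 1) + of_bool (x $ i = 1/2) / 2" for i
    using extreme_point_half_integral[of i] by auto
  then have "(\<Sum>i\<in>UNIV. x $ i) = (\<Sum>i\<in>UNIV. of_bool (x $ i = 1) + of_bool (x $ i = 1/2) / 2)"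
    by (rule sum.cong[OF refl])
  also have "\<dots> = (\<Sum>i\<in>UNIV. of_bool (x $ i = 1)) + (\<Sum>i\<in>UNIV. of_bool (x $ i = 1/2)) / 2"
    by (simp only: sum.distrib sum_divide_distrib)
  finally show ?thesis by (simp only: count half_vertices_def)
qed

lemma half_vertices_no_isolated:
  assumes "v \<in> half_vertices x"
  shows "\<exists>u\<in>half_vertices x. {v, u} \<in> E"
proof -
  have v: "x $ v = 1/2" using assms by (simp only: in_half_vertices_iff)
  then have "0 < x $ v" by simp
  then obtain u where "{v, u} \<in> E" "x $ u = 1 - x $ v"
    by (rule extreme_point_tight_edge)
  then show ?thesis using v by (intro bexI[of _ u]) (simp_all add: in_half_vertices_iff)
qed

lemma finite_adjacency_half:
  assumes "simple_graph E"
  shows "finite_adjacency (half_vertices x) (\<lambda>u v. {u, v} \<in> E)"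
proof unfold_locales
  show "finite (half_vertices x)" by simp
  show "{v, u} \<in> E" if "{u, v} \<in> E" for u v
    using that by (simp only: insert_commute)
  show "{u, u} \<notin> E" for u
    using assms by (force simp: simple_graph_def)
qed

text \<open>
  A vertex with value \<open>1\<close> has a private edge, namely a tight edge to a vertex with value \<open>0\<close>,
  and a half vertex outside \<open>S\<close> has a private edge into \<open>S\<close> because \<open>S\<close> is dominating. The smaller
  \<open>S\<close> is, the larger is the cover.
\<close>

lemma minimal_vertex_cover_of_extreme_point:
  assumes simple: "simple_graph E"
    and S: "finite_adjacency.independent (half_vertices x) (\<lambda>u v. {u, v} \<in> E) S"
      "finite_adjacency.dominating (half_vertices x) (\<lambda>u v. {u, v} \<in> E) S"
  shows "minimal_vertex_cover E ({i. x $ i = 1} \<union> (half_vertices x - S))" (is "minimal_vertex_cover E ?C")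
    and "card ({i. x $ i = 1} \<union> (half_vertices x - S)) + card S =
      card {i. x $ i = 1} + card (half_vertices x)"
proof -
  interpret finite_adjacency "half_vertices x" "\<lambda>u v. {u, v} \<in> E"
    using simple by (rule finite_adjacency_half)
  have SH: "S \<subseteq> half_vertices x" using S(1) by (simp add: independent_def)
  show "minimal_vertex_cover E ?C"
    unfolding minimal_vertex_cover_iff_private_edges[OF simple]
  proof (intro conjI allI impI ballI)
    fix u v assume uv: "{u, v} \<in> E"
    then have "x $ u = 1 \<or> x $ v = 1 \<or> x $ u = 1/2 \<and> x $ v = 1/2"
      using extreme_point_edge[OF uv] extreme_point_half_integral[of u]
        extreme_point_half_integral[of v] by auto
    then have "x $ u = 1 \<or> x $ v = 1 \<or> u \<in> half_vertices x \<and> v \<in> half_vertices x"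
      by (simp only: in_half_vertices_iff)
    moreover have "\<not> (u \<in> S \<and> v \<in> S)" using S(1) uv by (auto simp: independent_def)
    ultimately show "u \<in> ?C \<or> v \<in> ?C" by blast
  next
    fix u assume "u \<in> ?C"
    then consider "x $ u = 1" | "u \<in> half_vertices x - S" by auto
    then show "\<exists>v. v \<notin> ?C \<and> {u, v} \<in> E"
    proof cases
      case 1
      then have "0 < x $ u" by simp
      then obtain v where "{u, v} \<in> E" "x $ v = 1 - x $ u"
        by (rule extreme_point_tight_edge)
      then show ?thesis using 1 by (intro exI[of _ v]) (simp add: in_half_vertices_iff)
    next
      case 2
      then obtain s where "s \<in> S" "{u, s} \<in> E" using S(2) unfolding dominating_def by blast
      moreover from this SH have "x $ s = 1/2" by (auto simp only: in_half_vertices_iff)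
      ultimately show ?thesis by (intro exI[of _ s]) simp
    qed
  qed
  have "card ?C = card {i. x $ i = 1} + card (half_vertices x - S)"
    by (rule card_Un_disjoint) (auto simp: in_half_vertices_iff)
  moreover have "card (half_vertices x - S) + card S = card (half_vertices x)"
    using SH by (simp add: card_Diff_subset card_mono)
  ultimately show "card ?C + card S = card {i. x $ i = 1} + card (half_vertices x)" by simp
qed

text \<open>
  Along a bipartition the half vertices on one side could be raised and those on the other side
  lowered.
\<close>

lemma bipartite_no_half:
  assumes "bipartite E"
  shows "half_vertices x = {}"
proof -
  obtain A B where AB: "A \<inter> B = {}" "\<forall>e\<in>E. \<exists>a\<in>A. \<exists>b\<in>B. e = {a, b}"
    using assms unfolding bipartite_def by (elim exE conjE)
  define d :: "real ^ 'v" where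
    "d = (\<chi> i. if x $ i = 1/2 then if i \<in> A then 1 else -1 else 0)"
  have "d = 0"
  proof (rule extreme_point_rigid[OF ext])
    show "0 < x $ i" if "d $ i \<noteq> 0" for i
      using that by (auto simp: d_def split: if_splits)
    show "d $ i + d $ j = 0" if ij: "{i, j} \<in> E" "x $ i + x $ j = 1" for i j
    proof -
      obtain a b where "a \<in> A" "b \<in> B" "{i, j} = {a, b}"
        using AB(2) ij(1) by blast
      then have "i \<in> A \<longleftrightarrow> j \<notin> A" using AB(1) by (auto simp: doubleton_eq_iff)
      then show ?thesis using ij(2) by (auto simp: d_def)
    qed
  qed
  then have "d $ i = 0" for i by simp
  moreover have "d $ i \<noteq> 0" if "i \<in> half_vertices x" for i
    using that by (simp add: d_def half_vertices_def)
  ultimately show ?thesis by blast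
qed

end

lemma claw_free_adjacency:
  assumes "simple_graph E" "claw_free E"
    and "{c, p} \<in> E" "{c, q} \<in> E" "{c, r} \<in> E" "p \<noteq> q" "p \<noteq> r" "q \<noteq> r"
  shows "{p, q} \<in> E \<or> {p, r} \<in> E \<or> {q, r} \<in> E"
proof (rule ccontr)
  assume none: "\<not> ?thesis"
  have loop: "{v, v} \<notin> E" for v using assms(1) by (force simp: simple_graph_def)
  let ?L = "{p, q, r}"
  have "c \<notin> ?L" using assms(3-5) loop by auto
  moreover have "card ?L = 3" using assms(6-8) by simp
  moreover have "induced_edges E (insert c ?L) = complete_bipartite {c} ?L"
  proof
    show "complete_bipartite {c} ?L \<subseteq> induced_edges E (insert c ?L)"
      using assms(3-5) by (auto simp: induced_edges_def complete_bipartite_def)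
    show "induced_edges E (insert c ?L) \<subseteq> complete_bipartite {c} ?L"
    proof
      fix e assume "e \<in> induced_edges E (insert c ?L)"
      then have e: "e \<in> E" "e \<subseteq> insert c ?L" by (auto simp: induced_edges_def)
      then obtain a b where ab: "e = {a, b}" "a \<noteq> b"
        using assms(1) by (auto simp: simple_graph_def card_2_iff)
      then have "a = c \<and> b \<in> ?L \<or> b = c \<and> a \<in> ?L"
        using e none by (auto simp: insert_commute)
      then show "e \<in> complete_bipartite {c} ?L"
        using ab(1) unfolding complete_bipartite_def by blast
    qed
  qed
  ultimately have "\<exists>c L. c \<notin> L \<and> card L = 3 \<and> induced_edges E (insert c L) = complete_bipartite {c} L"
    by (intro exI conjI)
  then show False using assms(2) unfolding claw_free_def by (rule notE[rotated])
qed

text \<open>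
  In each of the three classes the half vertices \<open>H\<close> contain a maximal independent set \<open>S\<close> with
  \<open>2 |S| \<le> |H|\<close>, so the cover built from it has at least \<open>|H|/2\<close> elements besides the vertices
  with value \<open>1\<close>. In the unmixed case equicardinality passes from the covers of the whole graph
  to the maximal independent sets of \<open>H\<close>, since the size of the cover and the size of \<open>S\<close> have
  a constant sum.
\<close>

lemma extreme_point_sum_le_tau_max:
  fixes E :: "'v::finite set set"
  assumes simple: "simple_graph E" and cls: "bipartite E \<or> unmixed E \<or> claw_free E"
    and ext: "x extreme_point_of symbolic_polyhedron E"
  shows "(\<Sum>i\<in>UNIV. x $ i) \<le> real (tau_max E)"
proof -
  let ?H = "half_vertices x"
  interpret finite_adjacency ?H "\<lambda>u v. {u, v} \<in> E"
    using ext simple by (rule finite_adjacency_half)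
  note no_isolated = half_vertices_no_isolated[OF ext]
  note cover = minimal_vertex_cover_of_extreme_point[OF ext simple]
  obtain S where S: "independent S" "dominating S" "2 * card S \<le> card ?H"
    using cls
  proof (elim disjE)
    assume "bipartite E"
    then have H: "?H = {}" by (rule bipartite_no_half[OF ext])
    have "independent {}" by (simp add: independent_def)
    moreover have "dominating {}" unfolding dominating_def using H by simp
    ultimately show thesis by (rule that) simp
  next
    assume "unmixed E"
    have "card S = card T"
      if "independent S" "dominating S" "independent T" "dominating T" for S T
    proof -
      have "card ({i. x $ i = 1} \<union> (?H - S)) = card ({i. x $ i = 1} \<union> (?H - T))"
        using \<open>unmixed E\<close> cover(1)[OF that(1,2)] cover(1)[OF that(3,4)]
        unfolding unmixed_def by blast
      then show ?thesis using cover(2)[OF that(1,2)] cover(2)[OF that(3,4)] by linarith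
    qed
    from no_isolated this that show thesis
      by (rule equicardinal_maximal_independent_half)
  next
    assume "claw_free E"
    from no_isolated claw_free_adjacency[OF simple \<open>claw_free E\<close>] that show thesis
      by (rule claw_free_maximal_independent_half)
  qed
  let ?C = "{i. x $ i = 1} \<union> (?H - S)"
  have "card ?C \<le> tau_max E"
    by (rule card_minimal_vertex_cover_le_tau_max) (rule cover(1)[OF S(1,2)])
  then have "2 * card {i. x $ i = 1} + card ?H \<le> 2 * tau_max E"
    using cover(2)[OF S(1,2)] S(3) by linarith
  then have "real (2 * card {i. x $ i = 1} + card ?H) \<le> real (2 * tau_max E)"
    by (simp only: of_nat_le_iff)
  then show ?thesis unfolding extreme_point_sum[OF ext] by simp
qed

text \<open>
  The constraints that are tight at the indicator of \<open>C\<close> determine it: the coordinates outside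
  \<open>C\<close> are zero, and each coordinate in \<open>C\<close> is forced to be one by its private edge.
\<close>

lemma minimal_vertex_cover_extreme_point:
  fixes E :: "'v::finite set set"
  assumes simple: "simple_graph E" and C: "minimal_vertex_cover E C"
  shows "(\<chi> i. of_bool (i \<in> C)) extreme_point_of symbolic_polyhedron E" (is "?x extreme_point_of _")
proof -
  have cov: "\<And>u v. {u, v} \<in> E \<Longrightarrow> u \<in> C \<or> v \<in> C"
    and priv: "\<And>u. u \<in> C \<Longrightarrow> \<exists>v. v \<notin> C \<and> {u, v} \<in> E"
    using C unfolding minimal_vertex_cover_iff_private_edges[OF simple] by blast+
  show ?thesis unfolding extreme_point_of_def
  proof (intro conjI ballI notI)
    show "?x \<in> symbolic_polyhedron E"
      using cov by (fastforce simp: symbolic_polyhedron_def)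
    fix a b
    assume a: "a \<in> symbolic_polyhedron E" and b: "b \<in> symbolic_polyhedron E"
      and "?x \<in> open_segment a b"
    then obtain t where neq: "a \<noteq> b" and t: "0 < t" "t < 1" "?x = (1 - t) *\<^sub>R a + t *\<^sub>R b"
      by (auto simp: in_segment)
    have comp: "of_bool (i \<in> C) = (1 - t) * a $ i + t * b $ i" for i
      using arg_cong[OF t(3), of "\<lambda>y. y $ i"] by simp
    \<comment> \<open>A proper convex combination attains a common lower bound only if both points do.\<close>
    have squeeze: "p = m \<and> q = m" if "m = (1 - t) * p + t * q" "m \<le> p" "m \<le> q" for m p q :: real
    proof -
      have "(1 - t) * (p - m) + t * (q - m) = 0" using that(1) by (simp add: algebra_simps)
      moreover have "0 \<le> (1 - t) * (p - m)" "0 \<le> t * (q - m)" using that t by simp_all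
      ultimately have "(1 - t) * (p - m) = 0" "t * (q - m) = 0" by linarith+
      then show ?thesis using t by simp
    qed
    have out: "a $ i = 0 \<and> b $ i = 0" if i: "i \<notin> C" for i
      using a b comp[of i] i by (intro squeeze) (auto simp: symbolic_polyhedron_def)
    have "a $ i = 1 \<and> b $ i = 1" if i: "i \<in> C" for i
    proof -
      obtain j where j: "j \<notin> C" "{i, j} \<in> E" using priv[OF i] by blast
      then have "1 \<le> a $ i + a $ j" "1 \<le> b $ i + b $ j"
        using a b by (auto simp: symbolic_polyhedron_def)
      then show ?thesis
        using out[OF j(1)] comp[of i] i by (intro squeeze) auto
    qed
    with out have "a = b" by (metis vec_eq_iff)
    with neq show False by contradiction
  qed
qed

lemma delta_eq_tau_max:
  fixes E :: "'v::finite set set"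
  assumes simple: "simple_graph E" and cls: "bipartite E \<or> unmixed E \<or> claw_free E"
  shows "delta E = real (tau_max E)"
  unfolding delta_def
proof (rule Max_eqI)
  let ?V = "{\<Sum>i\<in>UNIV. v $ i |v. v extreme_point_of symbolic_polyhedron E}"
  \<comment> \<open>By half-integrality only finitely many values of the coordinate sum occur.\<close>
  have "?V \<subseteq> (\<lambda>(m, n). real m + real n / 2) ` ({..CARD('v)} \<times> {..CARD('v)})"
  proof
    fix s assume "s \<in> ?V"
    then obtain x where x: "x extreme_point_of symbolic_polyhedron E" "s = (\<Sum>i\<in>UNIV. x $ i)"
      by blast
    then show "s \<in> (\<lambda>(m, n). real m + real n / 2) ` ({..CARD('v)} \<times> {..CARD('v)})"
      by (intro image_eqI[of _ _ "(card {i. x $ i = 1}, card (half_vertices x))"])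
        (auto simp: extreme_point_sum intro: card_mono)
  qed
  then show "finite ?V" by (rule finite_subset) simp
  show "s \<le> real (tau_max E)" if "s \<in> ?V" for s
    using that extreme_point_sum_le_tau_max[OF simple cls] by blast
  obtain C where C: "minimal_vertex_cover E C" "card C = tau_max E"
    using tau_max_attained[OF simple] .
  define x :: "real ^ 'v" where "x = (\<chi> i. of_bool (i \<in> C))"
  have "real (tau_max E) = (\<Sum>i\<in>UNIV. x $ i)"
    by (simp add: x_def C(2))
  moreover have "x extreme_point_of symbolic_polyhedron E"
    unfolding x_def by (rule minimal_vertex_cover_extreme_point[OF simple C(1)])
  ultimately show "real (tau_max E) \<in> ?V" by blast
qed

section \<open>Monomial ideals\<close>

lemma ideal_gen_subset_iff:
  "ideal_gen S \<subseteq> ideal_gen T \<longleftrightarrow> S \<subseteq> ideal_gen T"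
  unfolding ideal_gen_def
  by (metis module.span_mono module.span_span module.span_superset module_times subset_trans)

abbreviation monomial :: "('v \<Rightarrow>\<^sub>0 nat) \<Rightarrow> ('v, 'k::comm_ring_1) mpoly" where
  "monomial m \<equiv> Poly_Mapping.single m 1"

lemma sum_of_terms:
  "(\<Sum>m\<in>Poly_Mapping.keys p. Poly_Mapping.single m (Poly_Mapping.lookup p m)) = p"
  by (rule poly_mapping_eqI)
    (auto simp: lookup_sum lookup_single when_def not_in_keys_iff_lookup_eq_zero)

lemma exponent_dvd_iff:
  fixes s m :: "'v \<Rightarrow>\<^sub>0 nat"
  shows "(\<exists>t. m = s + t) \<longleftrightarrow> (\<forall>v. Poly_Mapping.lookup s v \<le> Poly_Mapping.lookup m v)"
proof
  assume "\<forall>v. Poly_Mapping.lookup s v \<le> Poly_Mapping.lookup m v"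
  then have "m = s + (m - s)"
    by (intro poly_mapping_eqI) (simp add: lookup_add lookup_minus)
  then show "\<exists>t. m = s + t" ..
qed (auto simp: lookup_add)

text \<open>
  Divisibility by a generator survives multiplication by any polynomial, monomial by monomial.
  Conversely a polynomial is the sum of its terms, so it suffices to treat these one by one.
\<close>

lemma ideal_gen_monomials:
  "ideal_gen (monomial ` S :: ('v, 'k::comm_ring_1) mpoly set) =
    {p. \<forall>m\<in>Poly_Mapping.keys p. \<exists>s\<in>S. \<forall>v. Poly_Mapping.lookup s v \<le> Poly_Mapping.lookup m v}"
    (is "?I = {p. ?P p}")
proof (intro set_eqI iffI CollectI)
  fix p :: "('v, 'k) mpoly"
  assume "p \<in> ?I"
  then show "?P p" unfolding ideal_gen_def
  proof (induction rule: module.span_induct_alt[OF module_times, consumes 1])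
    case 1 then show ?case by simp
  next
    case (2 c x y)
    show ?case
    proof
      fix m assume "m \<in> Poly_Mapping.keys (c * x + y)"
      then have "m \<in> Poly_Mapping.keys (c * x) \<or> m \<in> Poly_Mapping.keys y"
        using keys_add[of "c * x" y] by blast
      then show "\<exists>s\<in>S. \<forall>v. Poly_Mapping.lookup s v \<le> Poly_Mapping.lookup m v"
      proof
        assume "m \<in> Poly_Mapping.keys (c * x)"
        moreover obtain s where s: "s \<in> S" "x = monomial s" using 2 by auto
        ultimately obtain t where "m = t + s"
          using keys_mult[of c x] by (auto split: if_splits)
        then show ?thesis using s(1) by (intro bexI[of _ s]) (simp_all add: lookup_add)
      next
        assume "m \<in> Poly_Mapping.keys y"
        then show ?thesis using 2 by blast
      qed
    qed
  qed
next
  fix p :: "('v, 'k) mpoly"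
  assume "p \<in> {p. ?P p}"
  then have p: "?P p" by simp
  have "Poly_Mapping.single m a \<in> ?I" if m: "m \<in> Poly_Mapping.keys p" for m a
  proof -
    obtain s t where st: "s \<in> S" "m = s + t"
      using p m by (metis exponent_dvd_iff)
    then have "Poly_Mapping.single m a = Poly_Mapping.single t a * monomial s"
      by (simp add: mult_single add.commute)
    then show ?thesis using st(1) unfolding ideal_gen_def
      by (metis image_eqI module.span_base module.span_scale module_times)
  qed
  then have "(\<Sum>m\<in>Poly_Mapping.keys p. Poly_Mapping.single m (Poly_Mapping.lookup p m)) \<in> ?I"
    unfolding ideal_gen_def by (intro module.span_sum[OF module_times])
  then show "p \<in> ?I" by (simp add: sum_of_terms)
qed

definition squarefree_exponent :: "'v::finite set \<Rightarrow> 'v \<Rightarrow>\<^sub>0 nat" where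
  "squarefree_exponent C = (\<Sum>v\<in>C. Poly_Mapping.single v 1)"

lemma lookup_squarefree_exponent:
  "Poly_Mapping.lookup (squarefree_exponent C) v = (if v \<in> C then 1 else 0)"
  by (simp add: squarefree_exponent_def lookup_sum lookup_single when_def)

lemma mon_degree_squarefree_exponent: "mon_degree (squarefree_exponent C) = card C"
  by (simp add: mon_degree_def lookup_squarefree_exponent sum.If_cases)

abbreviation cover_monomial :: "'v::finite set \<Rightarrow> ('v, 'k::comm_ring_1) mpoly" where
  "cover_monomial C \<equiv> monomial (squarefree_exponent C)"

lemma ideal_gen_cover_monomials:
  "ideal_gen (cover_monomial ` \<C> :: ('v::finite, 'k::comm_ring_1) mpoly set) =
    {p. \<forall>m\<in>Poly_Mapping.keys p. \<exists>C\<in>\<C>. C \<subseteq> {v. 0 < Poly_Mapping.lookup m v}}"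
proof -
  have "ideal_gen (cover_monomial ` \<C> :: ('v, 'k) mpoly set) =
      ideal_gen (monomial ` squarefree_exponent ` \<C>)"
    by (simp add: image_image)
  also have "\<dots> = {p. \<forall>m\<in>Poly_Mapping.keys p. \<exists>C\<in>\<C>. C \<subseteq> {v. 0 < Poly_Mapping.lookup m v}}"
    unfolding ideal_gen_monomials
    by (auto simp: lookup_squarefree_exponent subset_iff Suc_le_eq cong: bex_cong)
  finally show ?thesis .
qed

text \<open>
  Membership in the ideal of an edge says that each monomial involves one of its two ends. For all
  edges together this says that the support of each monomial is a vertex cover, that is, contains
  a minimal one.
\<close>

lemma cover_ideal_eq_ideal_gen_minimal_covers:
  fixes E :: "'v::finite set set"
  shows "(cover_ideal E :: ('v, 'k::comm_ring_1) mpoly set) =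
    ideal_gen (cover_monomial ` {C. minimal_vertex_cover E C})"
proof -
  have var: "var v = (cover_monomial {v} :: ('v, 'k) mpoly)" for v
    by (simp add: var_def squarefree_exponent_def)
  have edge: "ideal_gen (var ` e :: ('v, 'k) mpoly set) =
      {p. \<forall>m\<in>Poly_Mapping.keys p. {v. 0 < Poly_Mapping.lookup m v} \<inter> e \<noteq> {}}" for e
  proof -
    have "var ` e = (cover_monomial ` (\<lambda>v. {v}) ` e :: ('v, 'k) mpoly set)"
      by (simp add: image_image var)
    then show ?thesis by (simp only: ideal_gen_cover_monomials) auto
  qed
  have "(cover_ideal E :: ('v, 'k) mpoly set) =
      {p. \<forall>m\<in>Poly_Mapping.keys p. vertex_cover E {v. 0 < Poly_Mapping.lookup m v}}"
    by (auto simp: cover_ideal_def edge vertex_cover_def)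
  also have "\<dots> = ideal_gen (cover_monomial ` {C. minimal_vertex_cover E C})"
  proof -
    have "vertex_cover E D \<longleftrightarrow> (\<exists>C\<in>{C. minimal_vertex_cover E C}. C \<subseteq> D)" for D
    proof
      assume "vertex_cover E D"
      then obtain C where "C \<subseteq> D" "minimal_vertex_cover E C"
        by (rule vertex_cover_contains_minimal)
      then show "\<exists>C\<in>{C. minimal_vertex_cover E C}. C \<subseteq> D" by blast
    next
      assume "\<exists>C\<in>{C. minimal_vertex_cover E C}. C \<subseteq> D"
      then show "vertex_cover E D"
        by (auto simp: minimal_vertex_cover_def intro: vertex_cover_mono)
    qed
    then show ?thesis by (simp only: ideal_gen_cover_monomials)
  qed
  finally show ?thesis .
qed

section \<open>Degrees of minimal generators\<close>

lemma homogeneous_mon_degree: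
  assumes "homogeneous f" "m \<in> Poly_Mapping.keys f"
  shows "mon_degree m = total_degree f"
proof -
  obtain d where d: "\<forall>m\<in>Poly_Mapping.keys f. mon_degree m = d"
    using assms(1) by (auto simp: homogeneous_def)
  then have "mon_degree ` Poly_Mapping.keys f = (\<lambda>_. d) ` Poly_Mapping.keys f"
    by (intro image_cong) auto
  then show ?thesis
    using d assms(2) by (auto simp: total_degree_def image_constant_conv)
qed

lemma mon_degree_add: "mon_degree (a + b) = mon_degree a + mon_degree b"
  by (simp add: mon_degree_def lookup_add sum.distrib)

definition truncate_degree ::
    "nat \<Rightarrow> ('v::finite, 'k::comm_ring_1) mpoly \<Rightarrow> ('v, 'k) mpoly" where
  "truncate_degree d = Poly_Mapping.mapp (\<lambda>m c. c when mon_degree m \<le> d)"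

lemma lookup_truncate_degree:
  "Poly_Mapping.lookup (truncate_degree d p) m = (Poly_Mapping.lookup p m when mon_degree m \<le> d)"
  by (cases "m \<in> Poly_Mapping.keys p")
    (auto simp: truncate_degree_def lookup_mapp not_in_keys_iff_lookup_eq_zero)

lemma truncate_degree_zero: "truncate_degree d 0 = 0"
  by (rule poly_mapping_eqI) (simp add: lookup_truncate_degree)

lemma truncate_degree_add:
  "truncate_degree d (p + q) = truncate_degree d p + truncate_degree d q"
  by (rule poly_mapping_eqI) (simp add: lookup_truncate_degree lookup_add when_add_distrib)

lemma truncate_degree_sum:
  "truncate_degree d (\<Sum>i\<in>A. f i) = (\<Sum>i\<in>A. truncate_degree d (f i))"
  by (induction A rule: infinite_finite_induct)
    (simp_all add: truncate_degree_zero truncate_degree_add)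

lemma truncate_degree_homogeneous:
  assumes "\<And>m. m \<in> Poly_Mapping.keys p \<Longrightarrow> mon_degree m = e"
  shows "truncate_degree d p = (if e \<le> d then p else 0)"
proof (rule poly_mapping_eqI)
  fix m
  show "Poly_Mapping.lookup (truncate_degree d p) m =
      Poly_Mapping.lookup (if e \<le> d then p else 0) m"
  proof (cases "m \<in> Poly_Mapping.keys p")
    case True
    then show ?thesis using assms[OF True] by (simp add: lookup_truncate_degree)
  next
    case False
    then have "Poly_Mapping.lookup p m = 0" by (simp add: not_in_keys_iff_lookup_eq_zero)
    then show ?thesis by (simp add: lookup_truncate_degree)
  qed
qed

text \<open>
  In a product of a term with a homogeneous generator all monomials have the same degree, at least
  that of the generator. Truncation keeps the product or removes it, and it keeps it
  only if the degree of the generator is at most \<open>d\<close>.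
\<close>

lemma truncate_degree_in_ideal:
  fixes B :: "('v::finite, 'k::comm_ring_1) mpoly set"
  assumes hom: "\<forall>f\<in>B. homogeneous f" and p: "p \<in> ideal_gen B"
  shows "truncate_degree d p \<in> ideal_gen {g \<in> B. total_degree g \<le> d}" (is "_ \<in> ?N")
  using p unfolding ideal_gen_def[of B]
proof (induction rule: module.span_induct_alt[OF module_times, consumes 1])
  case 1
  show ?case
    unfolding truncate_degree_zero ideal_gen_def by (rule module.span_zero[OF module_times])
next
  case (2 h g q)
  have single: "truncate_degree d (Poly_Mapping.single m a * g) \<in> ?N" for m a
  proof -
    have keys: "mon_degree n = mon_degree m + total_degree g"
      if n: "n \<in> Poly_Mapping.keys (Poly_Mapping.single m a * g)" for n
    proof -
      obtain k where "n = m + k" "k \<in> Poly_Mapping.keys g"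
        using n keys_mult[of "Poly_Mapping.single m a" g] by (auto split: if_splits)
      then show ?thesis
        using homogeneous_mon_degree[of g k] hom 2 by (simp add: mon_degree_add)
    qed
    have "Poly_Mapping.single m a * g \<in> ?N" if "mon_degree m + total_degree g \<le> d"
      using that 2 unfolding ideal_gen_def
      by (intro module.span_scale[OF module_times] module.span_base[OF module_times]) auto
    moreover have "0 \<in> ?N"
      unfolding ideal_gen_def by (rule module.span_zero[OF module_times])
    moreover have "truncate_degree d (Poly_Mapping.single m a * g) =
        (if mon_degree m + total_degree g \<le> d then Poly_Mapping.single m a * g else 0)"
      by (rule truncate_degree_homogeneous) (rule keys)
    ultimately show ?thesis by simp
  qed
  have "h * g = (\<Sum>m\<in>Poly_Mapping.keys h. Poly_Mapping.single m (Poly_Mapping.lookup h m) * g)"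
    by (metis sum_distrib_right sum_of_terms)
  then have "truncate_degree d (h * g) \<in> ?N"
    unfolding ideal_gen_def
    by (auto simp: truncate_degree_sum intro!: module.span_sum[OF module_times]
        single[unfolded ideal_gen_def])
  then show ?case
    using 2 unfolding truncate_degree_add ideal_gen_def
    by (intro module.span_add[OF module_times])
qed

text \<open>
  Truncating the representations of the known generators at degree \<open>d\<close> shows that generators
  of larger degree are superfluous. Thus one homogeneous generating set of degree at most \<open>d\<close>
  bounds the degrees in all the minimal ones.
\<close>

lemma total_degree_minimal_generator_le:
  fixes I :: "('v::finite, 'k::comm_ring_1) mpoly set"
  assumes M: "ideal_gen M = I" "\<And>p. p \<in> M \<Longrightarrow> homogeneous p" "\<And>p. p \<in> M \<Longrightarrow> total_degree p \<le> d"
    and B: "minimal_homogeneous_generators I B" "f \<in> B"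
  shows "total_degree f \<le> d"
proof (rule ccontr)
  assume f: "\<not> total_degree f \<le> d"
  have hom: "\<forall>f\<in>B. homogeneous f" and gen: "ideal_gen B = I"
    using B(1) by (auto simp: minimal_homogeneous_generators_def)
  have "p \<in> ideal_gen (B - {f})" if p: "p \<in> M" for p
  proof -
    have "p \<in> ideal_gen B"
      using p M(1) gen by (metis ideal_gen_subset_iff subset_iff order_refl)
    then have "truncate_degree d p \<in> ideal_gen {g \<in> B. total_degree g \<le> d}"
      by (rule truncate_degree_in_ideal[OF hom])
    also have "\<dots> \<subseteq> ideal_gen (B - {f})"
      unfolding ideal_gen_def using f by (intro module.span_mono[OF module_times]) auto
    also have "truncate_degree d p = (if total_degree p \<le> d then p else 0)"
      by (rule truncate_degree_homogeneous) (rule homogeneous_mon_degree[OF M(2)[OF p]])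
    also have "\<dots> = p" using M(3)[OF p] by simp
    finally show ?thesis .
  qed
  then have "I \<subseteq> ideal_gen (B - {f})"
    using M(1) ideal_gen_subset_iff by blast
  moreover have "ideal_gen (B - {f}) \<subseteq> I"
    unfolding gen[symmetric] ideal_gen_def by (intro module.span_mono[OF module_times]) auto
  ultimately have "ideal_gen (B - {f}) = I" by blast
  moreover have "B - {f} \<subset> B" using B(2) by auto
  ultimately show False
    using B(1) by (auto simp: minimal_homogeneous_generators_def)
qed

lemma homogeneous_monomial: "homogeneous (monomial m :: ('v::finite, 'k::comm_ring_1) mpoly)"
  by (simp add: homogeneous_def)

lemma total_degree_monomial:
  "total_degree (monomial m :: ('v::finite, 'k::comm_ring_1) mpoly) = mon_degree m"
  by (simp add: total_degree_def)

text \<open>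
  A squarefree monomial \<open>x\<^sub>C\<close> in the ideal generated by others \<open>x\<^sub>D\<close> is divisible by one of these,
  and then \<open>D \<subseteq> C\<close>, which for minimal covers means \<open>D = C\<close>.
\<close>

lemma cover_monomials_minimal_generators:
  fixes E :: "'v::finite set set"
  shows "minimal_homogeneous_generators (cover_ideal E :: ('v, 'k::comm_ring_1) mpoly set)
    (cover_monomial ` {C. minimal_vertex_cover E C})"
  unfolding minimal_homogeneous_generators_def
proof (intro conjI allI impI notI)
  let ?M = "cover_monomial ` {C. minimal_vertex_cover E C} :: ('v, 'k) mpoly set"
  show "\<forall>f\<in>?M. homogeneous f" by (auto simp: homogeneous_monomial)
  show "ideal_gen ?M = cover_ideal E" by (simp add: cover_ideal_eq_ideal_gen_minimal_covers)
  fix B' assume B': "B' \<subset> ?M" "ideal_gen B' = (cover_ideal E :: ('v, 'k) mpoly set)"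
  then obtain C where C: "minimal_vertex_cover E C" "cover_monomial C \<notin> B'" by blast
  define \<C> where "\<C> = {D. minimal_vertex_cover E D \<and> (cover_monomial D :: ('v, 'k) mpoly) \<in> B'}"
  have "B' = cover_monomial ` \<C>" using B'(1) by (auto simp: \<C>_def)
  moreover have "cover_monomial C \<in> ideal_gen B'"
    using C(1) unfolding B'(2) cover_ideal_eq_ideal_gen_minimal_covers
    unfolding ideal_gen_def by (intro module.span_base[OF module_times]) auto
  ultimately obtain D where "D \<in> \<C>" "D \<subseteq> C"
    by (auto simp: ideal_gen_cover_monomials lookup_squarefree_exponent split: if_splits)
  moreover from this C(1) have "D = C"
    by (auto simp: \<C>_def minimal_vertex_cover_def)
  ultimately show False using C(2) by (simp add: \<C>_def)
qed

lemma omega_cover_ideal: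
  fixes E :: "'v::finite set set"
  assumes "simple_graph E"
  shows "omega (cover_ideal E :: ('v, 'k::comm_ring_1) mpoly set) = tau_max E"
  unfolding omega_def
proof (rule Max_eqI)
  let ?M = "cover_monomial ` {C. minimal_vertex_cover E C} :: ('v, 'k) mpoly set"
  let ?D = "{total_degree f |f B. minimal_homogeneous_generators
    (cover_ideal E :: ('v, 'k) mpoly set) B \<and> f \<in> B}"
  have bound: "d \<le> tau_max E" if "d \<in> ?D" for d
  proof -
    obtain f B where fB: "d = total_degree f" "f \<in> B"
      "minimal_homogeneous_generators (cover_ideal E :: ('v, 'k) mpoly set) B"
      using \<open>d \<in> ?D\<close> by blast
    show ?thesis unfolding fB(1)
    proof (rule total_degree_minimal_generator_le[OF _ _ _ fB(3,2)])
      show "ideal_gen ?M = cover_ideal E" by (simp add: cover_ideal_eq_ideal_gen_minimal_covers)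
    qed (auto simp: homogeneous_monomial total_degree_monomial mon_degree_squarefree_exponent
          card_minimal_vertex_cover_le_tau_max)
  qed
  have "?D \<subseteq> {..tau_max E}" using bound by blast
  then show "finite ?D" by (rule finite_subset) simp
  show "d \<le> tau_max E" if "d \<in> ?D" for d by (rule bound[OF that])
  obtain C where C: "minimal_vertex_cover E C" "card C = tau_max E"
    using tau_max_attained[OF assms] .
  have "total_degree (cover_monomial C :: ('v, 'k) mpoly) = tau_max E"
    by (simp add: total_degree_monomial mon_degree_squarefree_exponent C(2))
  moreover have "(cover_monomial C :: ('v, 'k) mpoly) \<in> ?M" using C(1) by simp
  ultimately have "tau_max E = total_degree (cover_monomial C :: ('v, 'k) mpoly) \<and>
      minimal_homogeneous_generators (cover_ideal E) ?M \<and> cover_monomial C \<in> ?M"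
    using cover_monomials_minimal_generators[of E, where ?'k = 'k] by simp
  then show "tau_max E \<in> ?D"
    by (intro CollectI exI)
qed

section \<open>Equality of the three invariants\<close>

theorem theorem4p9:
  fixes E :: "'v::finite set set"
  assumes "simple_graph E"
    and "no_isolated_vertices E"
    and "bipartite E \<or> unmixed E \<or> claw_free E"
  shows "delta E = real (omega (cover_ideal E :: ('v, 'k::field) mpoly set))
    \<and> omega (cover_ideal E :: ('v, 'k) mpoly set) = tau_max E"
  unfolding omega_cover_ideal[OF assms(1)]
  using delta_eq_tau_max[OF assms(1,3)] by simp

end
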